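(* Let $\mathfrak{g}$ be a non Abelian finite dimensional complex quadratic Lie algebra with bilinear form $B$. Then there exist a central ideal $\mathfrak{z}$ and an ideal $\mathfrak{l}\ne\{0\}$ such that: (1) $\mathfrak{g}=\mathfrak{z}\oplus\mathfrak{l}$, and $\mathfrak{l}$ and $\mathfrak{z}$ are orthogonal with respect to $B$. (2) The ideals $\mathfrak{z}$ and $\mathfrak{l}$ are quadratic (with bilinear forms induced by the restriction of $B$) and $\mathfrak{l}$ is non Abelian. Moreover, $\mathfrak{l}$ is elementary if and only if $\mathfrak{g}$ is elementary. (3) The center $Z(\mathfrak{l})$ is totally isotropic and $$\dim(Z(\mathfrak{l}))\le\tfrac12\dim(\mathfrak{l})\le\dim([\mathfrak{l},\mathfrak{l}]).$$
   Context: A quadratic Lie algebra is a Lie algebra with a non degenerate symmetric invariant bilinear form $B$. $Z(\cdot)$ denotes the center. A quadratic Lie algebra $\mathfrak{g}$ is called elementary if the skew symmetric trilinear form $I_{\mathfrak{g}}(X,Y,Z)=B([X,Y],Z)$ is decomposable, i.e. $I_{\mathfrak{g}}=\omega_1\wedge\omega_2\wedge\omega_3$ with $\omega_1,\omega_2,\omega_3\in\mathfrak{g}^*$. A subspace is totally isotropic if $B$ vanishes identically on it. *)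

theory Defs
  imports Complex_Main
begin

text \<open>
  A Lie algebra is carried by a subspace \<open>g\<close> of an ambient complex vector space, so that an
  ideal is a Lie algebra for the very same bracket and bilinear form. Only the values of
  \<open>br\<close> and \<open>B\<close> on the carrier matter.
\<close>

locale lie_algebra = vector_space scale
  for scale :: "complex \<Rightarrow> 'a::ab_group_add \<Rightarrow> 'a" +
  fixes g :: "'a set" and br :: "'a \<Rightarrow> 'a \<Rightarrow> 'a"
  assumes subspace_carrier: "subspace g"
    and br_closed: "\<lbrakk>x \<in> g; y \<in> g\<rbrakk> \<Longrightarrow> br x y \<in> g"
    and br_add_left: "\<lbrakk>x \<in> g; y \<in> g; z \<in> g\<rbrakk> \<Longrightarrow> br (x + y) z = br x z + br y z"
    and br_add_right: "\<lbrakk>x \<in> g; y \<in> g; z \<in> g\<rbrakk> \<Longrightarrow> br x (y + z) = br x y + br x z"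
    and br_scale_left: "\<lbrakk>x \<in> g; y \<in> g\<rbrakk> \<Longrightarrow> br (scale c x) y = scale c (br x y)"
    and br_scale_right: "\<lbrakk>x \<in> g; y \<in> g\<rbrakk> \<Longrightarrow> br x (scale c y) = scale c (br x y)"
    and br_alternating: "x \<in> g \<Longrightarrow> br x x = 0"
    and jacobi: "\<lbrakk>x \<in> g; y \<in> g; z \<in> g\<rbrakk> \<Longrightarrow>
      br x (br y z) + br y (br z x) + br z (br x y) = 0"

locale quadratic_lie_algebra = lie_algebra scale g br
  for scale :: "complex \<Rightarrow> 'a::ab_group_add \<Rightarrow> 'a" and g br +
  fixes B :: "'a \<Rightarrow> 'a \<Rightarrow> complex"
  assumes form_add_left: "\<lbrakk>x \<in> g; y \<in> g; z \<in> g\<rbrakk> \<Longrightarrow> B (x + y) z = B x z + B y z"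
    and form_scale_left: "\<lbrakk>x \<in> g; y \<in> g\<rbrakk> \<Longrightarrow> B (scale c x) y = c * B x y"
    and form_sym: "\<lbrakk>x \<in> g; y \<in> g\<rbrakk> \<Longrightarrow> B x y = B y x"
    and form_invariant: "\<lbrakk>x \<in> g; y \<in> g; z \<in> g\<rbrakk> \<Longrightarrow> B (br x y) z = B x (br y z)"
    and form_nondegenerate: "\<lbrakk>x \<in> g; \<And>y. y \<in> g \<Longrightarrow> B x y = 0\<rbrakk> \<Longrightarrow> x = 0"

definition finite_dim :: "(complex \<Rightarrow> 'a::ab_group_add \<Rightarrow> 'a) \<Rightarrow> 'a set \<Rightarrow> bool" where
  "finite_dim scale V \<longleftrightarrow> (\<exists>S. finite S \<and> module.span scale S = V)"

definition lie_ideal ::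
  "(complex \<Rightarrow> 'a::ab_group_add \<Rightarrow> 'a) \<Rightarrow> 'a set \<Rightarrow> ('a \<Rightarrow> 'a \<Rightarrow> 'a) \<Rightarrow> 'a set \<Rightarrow> bool" where
  "lie_ideal scale g br h \<longleftrightarrow>
     module.subspace scale h \<and> h \<subseteq> g \<and> (\<forall>x\<in>g. \<forall>y\<in>h. br x y \<in> h)"

definition lie_center :: "'a set \<Rightarrow> ('a \<Rightarrow> 'a \<Rightarrow> 'a::zero) \<Rightarrow> 'a set" where
  "lie_center g br = {x \<in> g. \<forall>y\<in>g. br x y = 0}"

definition abelian :: "'a set \<Rightarrow> ('a \<Rightarrow> 'a \<Rightarrow> 'a::zero) \<Rightarrow> bool" where
  "abelian g br \<longleftrightarrow> (\<forall>x\<in>g. \<forall>y\<in>g. br x y = 0)"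

definition derived_algebra ::
  "(complex \<Rightarrow> 'a::ab_group_add \<Rightarrow> 'a) \<Rightarrow> 'a set \<Rightarrow> ('a \<Rightarrow> 'a \<Rightarrow> 'a) \<Rightarrow> 'a set" where
  "derived_algebra scale g br = module.span scale {br x y | x y. x \<in> g \<and> y \<in> g}"

definition direct_sum_of :: "'a::ab_group_add set \<Rightarrow> 'a set \<Rightarrow> 'a set \<Rightarrow> bool" where
  "direct_sum_of V U W \<longleftrightarrow> V = {u + w | u w. u \<in> U \<and> w \<in> W} \<and> U \<inter> W = {0}"

definition orthogonal_wrt :: "('a \<Rightarrow> 'a \<Rightarrow> complex) \<Rightarrow> 'a set \<Rightarrow> 'a set \<Rightarrow> bool" where
  "orthogonal_wrt B U W \<longleftrightarrow> (\<forall>u\<in>U. \<forall>w\<in>W. B u w = 0)"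

definition totally_isotropic :: "('a \<Rightarrow> 'a \<Rightarrow> complex) \<Rightarrow> 'a set \<Rightarrow> bool" where
  "totally_isotropic B U \<longleftrightarrow> (\<forall>u\<in>U. \<forall>v\<in>U. B u v = 0)"

text \<open>Elements of the dual of \<open>V\<close>; values outside \<open>V\<close> are irrelevant.\<close>

definition linear_form_on ::
  "(complex \<Rightarrow> 'a::ab_group_add \<Rightarrow> 'a) \<Rightarrow> 'a set \<Rightarrow> ('a \<Rightarrow> complex) \<Rightarrow> bool" where
  "linear_form_on scale V w \<longleftrightarrow>
     (\<forall>x\<in>V. \<forall>y\<in>V. w (x + y) = w x + w y) \<and> (\<forall>c. \<forall>x\<in>V. w (scale c x) = c * w x)"

text \<open>
  The wedge product of three linear forms, as the determinant of the values \<open>w\<^sub>i x\<^sub>j\<close>.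
  The other usual normalisation differs by the factor \<open>1/6\<close>, which does not affect
  decomposability.
\<close>

definition wedge3 ::
  "('a \<Rightarrow> complex) \<Rightarrow> ('a \<Rightarrow> complex) \<Rightarrow> ('a \<Rightarrow> complex) \<Rightarrow> 'a \<Rightarrow> 'a \<Rightarrow> 'a \<Rightarrow> complex" where
  "wedge3 w1 w2 w3 x y z =
     w1 x * w2 y * w3 z + w1 y * w2 z * w3 x + w1 z * w2 x * w3 y
     - w1 x * w2 z * w3 y - w1 y * w2 x * w3 z - w1 z * w2 y * w3 x"

definition elementary ::
  "(complex \<Rightarrow> 'a::ab_group_add \<Rightarrow> 'a) \<Rightarrow> 'a set \<Rightarrow> ('a \<Rightarrow> 'a \<Rightarrow> 'a) \<Rightarrow> ('a \<Rightarrow> 'a \<Rightarrow> complex) \<Rightarrow> bool"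
where
  "elementary scale g br B \<longleftrightarrow>
     (\<exists>w1 w2 w3. linear_form_on scale g w1 \<and> linear_form_on scale g w2 \<and>
        linear_form_on scale g w3 \<and>
        (\<forall>x\<in>g. \<forall>y\<in>g. \<forall>z\<in>g. B (br x y) z = wedge3 w1 w2 w3 x y z))"

end

theory Submission
  imports Defs
begin

text \<open>
  Split off nonisotropic central lines one at a time: if \<open>\<gg> = \<zz> \<oplus> \<ll>\<close> is an orthogonal
  splitting with \<open>\<zz>\<close> central and some \<open>x \<in> Z(\<ll>)\<close> has \<open>B(x,x) \<noteq> 0\<close>, then \<open>x\<close> can be moved
  from \<open>\<ll>\<close> to \<open>\<zz>\<close>, replacing \<open>\<ll>\<close> by \<open>\<ll> \<inter> x\<^sup>\<bottom>\<close>. When the dimension of \<open>\<ll>\<close> is minimal,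
  polarisation makes \<open>Z(\<ll>)\<close> totally isotropic. An isotropic subspace has at most half the
  dimension, and invariance gives \<open>[\<ll>,\<ll>]\<^sup>\<bottom> \<subseteq> Z(\<ll>)\<close>, whence
  \<open>dim \<ll> \<le> dim Z(\<ll>) + dim [\<ll>,\<ll>]\<close>. Brackets and \<open>I\<^sub>\<gg>\<close> only see the
  \<open>\<ll>\<close>-components, so elementarity passes between \<open>\<gg>\<close> and \<open>\<ll>\<close>.
\<close>

section \<open>Dimension counting for subspaces contained in the span of a finite set\<close>

context vector_space
begin

lemma finite_basis_of_subset:
  assumes "finite S" "V \<subseteq> span S"
  obtains b where "finite b" "b \<subseteq> V" "independent b" "V \<subseteq> span b" "card b = dim V"
proof -
  obtain b where b: "b \<subseteq> V" "independent b" "V \<subseteq> span b" "card b = dim V"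
    by (rule basis_exists)
  then have "finite b"
    using independent_span_bound[of S b] assms by blast
  then show ?thesis
    using b that by blast
qed

text \<open>The finite spanning set is essential: \<open>dim\<close> is the \<open>card\<close> of a
  basis, and \<open>card\<close> is 0 on infinite sets, so an infinite dimensional \<open>V\<close>
  would have dimension 0.\<close>

lemma dim_mono_finite:
  assumes "finite S" "V \<subseteq> span S" "U \<subseteq> V"
  shows "dim U \<le> dim V"
proof -
  obtain b where "finite b" "V \<subseteq> span b" "card b = dim V"
    using finite_basis_of_subset assms by metis
  then show ?thesis
    using dim_le_card[of U b] assms by auto
qed

text \<open>A basis of \<open>U\<close> stays independent when a vector of \<open>V\<close> outside
  \<open>U\<close> is added. This strictness contradicts minimality when the summand
  \<open>l\<close> can be shrunk.\<close>

lemma dim_less_of_psubset: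
  assumes "finite S" "V \<subseteq> span S" "subspace U" "U \<subset> V"
  shows "dim U < dim V"
proof -
  obtain b where b: "finite b" "b \<subseteq> U" "independent b" "U \<subseteq> span b" "card b = dim U"
    using finite_basis_of_subset[of S U] assms by blast
  obtain v where v: "v \<in> V" "v \<notin> U"
    using assms by blast
  have "span b \<subseteq> U"
    using b assms by (simp add: span_minimal)
  with v have "v \<notin> span b" by blast
  then have ins: "independent (insert v b)" "v \<notin> b"
    using b independent_insertI span_base by auto
  have "dim (insert v b) = Suc (dim U)"
    using dim_eq_card_independent[OF ins(1)] ins b by simp
  moreover have "dim (insert v b) \<le> dim V"
    using dim_mono_finite[OF assms(1,2), of "insert v b"] v b assms by blast
  ultimately show ?thesis by simp
qed

lemma dim_zero_subspace: "dim {0} = 0"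
  using dim_unique[of "{}" "{0}" 0] independent_empty by simp

text \<open>If f(v) \<noteq> 0, every x differs from a kernel element by (f(x)/f(v)) v, so a basis
  of the kernel together with v spans \<open>V\<close>. Linearity is asked only on \<open>V\<close>,
  since the bilinear form is controlled only on the carrier.\<close>

lemma dim_le_Suc_dim_kernel:
  assumes fin: "finite S" "V \<subseteq> span S" and V: "subspace V"
    and add: "\<And>x y. x \<in> V \<Longrightarrow> y \<in> V \<Longrightarrow> f (x + y) = f x + f y"
    and hom: "\<And>c x. x \<in> V \<Longrightarrow> f (scale c x) = c * f x"
  shows "dim V \<le> Suc (dim {x \<in> V. f x = 0})"
proof (cases "\<exists>v\<in>V. f v \<noteq> 0")
  case False
  then have "{x \<in> V. f x = 0} = V" by auto
  then show ?thesis by simp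
next
  case True
  then obtain v where v: "v \<in> V" "f v \<noteq> 0" by blast
  have "{x \<in> V. f x = 0} \<subseteq> span S" using fin by blast
  then obtain b where b: "finite b" "b \<subseteq> {x \<in> V. f x = 0}" "{x \<in> V. f x = 0} \<subseteq> span b"
    "card b = dim {x \<in> V. f x = 0}"
    by (rule finite_basis_of_subset[OF fin(1)])
  have "V \<subseteq> span (insert v b)"
  proof
    fix x assume x: "x \<in> V"
    let ?y = "x + scale (- (f x / f v)) v"
    have sv: "scale (- (f x / f v)) v \<in> V" using V v subspace_scale by blast
    then have y: "?y \<in> V" using V x subspace_add by blast
    have "f ?y = f x + - (f x / f v) * f v"
      by (simp only: add[OF x sv] hom[OF v(1)])
    also have "\<dots> = 0" using v by simp
    finally have "?y \<in> span b" using y b by blast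
    then have "x - scale (f x / f v) v \<in> span b" by simp
    then show "x \<in> span (insert v b)" using span_breakdown_eq by blast
  qed
  then have "dim V \<le> card (insert v b)" using b dim_le_card by blast
  also have "\<dots> \<le> Suc (card b)" using b(1) by (simp add: card_insert_if)
  finally show ?thesis using b by simp
qed

text \<open>Imposing the equations one at a time, each lowers the dimension by at most one.\<close>

lemma dim_le_dim_common_kernel:
  assumes fin: "finite S" "V \<subseteq> span S" and V: "subspace V" and I: "finite I"
    and add: "\<And>i x y. i \<in> I \<Longrightarrow> x \<in> V \<Longrightarrow> y \<in> V \<Longrightarrow> f i (x + y) = f i x + f i y"
    and hom: "\<And>i c x. i \<in> I \<Longrightarrow> x \<in> V \<Longrightarrow> f i (scale c x) = c * f i x"
  shows "dim V \<le> dim {x \<in> V. \<forall>i\<in>I. f i x = 0} + card I"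
  using I add hom
proof (induction I rule: finite_induct)
  case empty
  then show ?case by simp
next
  case (insert i I)
  let ?K = "{x \<in> V. \<forall>i\<in>I. f i x = 0}"
  have zero: "f j 0 = 0" if "j \<in> I" for j
    using insert.prems(2)[of j 0 0] that V subspace_0 by simp
  have K: "subspace ?K"
    unfolding subspace_def
    using V insert.prems zero by (auto simp: subspace_0 subspace_add subspace_scale)
  have "?K \<subseteq> span S" using fin by blast
  then have "dim ?K \<le> Suc (dim {x \<in> ?K. f i x = 0})"
    using dim_le_Suc_dim_kernel[OF fin(1) _ K, of "f i"] insert.prems by simp
  moreover have "{x \<in> ?K. f i x = 0} = {x \<in> V. \<forall>j\<in>insert i I. f j x = 0}" by auto
  moreover have "dim V \<le> dim ?K + card I"
    using insert.IH insert.prems by simp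
  ultimately show ?case using insert.hyps by simp
qed

end

section \<open>Elementary facts on brackets, the center and the derived algebra\<close>

context lie_algebra
begin

lemma br_zero_left: "x \<in> g \<Longrightarrow> br 0 x = 0"
  using br_add_left[of 0 0 x] subspace_0[OF subspace_carrier] by simp

lemma br_swap:
  assumes "x \<in> g" "y \<in> g"
  shows "br y x = - br x y"
proof -
  have xy: "x + y \<in> g" using assms subspace_add[OF subspace_carrier] by blast
  have "0 = br (x + y) (x + y)" using br_alternating[OF xy] by simp
  also have "\<dots> = br x y + br y x"
    using assms xy br_alternating[of x] br_alternating[of y]
    by (simp add: br_add_left br_add_right)
  finally show ?thesis by (metis minus_unique)
qed

lemma subspace_lie_center: "subspace (lie_center g br)"
  unfolding subspace_def lie_center_def
  using subspace_carrier
  by (auto simp: br_zero_left br_add_left br_scale_left subspace_0 subspace_add subspace_scale)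

lemma lie_center_right: "\<lbrakk>x \<in> lie_center g br; y \<in> g\<rbrakk> \<Longrightarrow> br y x = 0"
  using br_swap[of x y] by (auto simp: lie_center_def)

lemma br_in_derived_algebra: "\<lbrakk>x \<in> g; y \<in> g\<rbrakk> \<Longrightarrow> br x y \<in> derived_algebra scale g br"
  unfolding derived_algebra_def by (rule span_base) blast

lemma derived_algebra_subset: "derived_algebra scale g br \<subseteq> g"
  unfolding derived_algebra_def by (rule span_minimal) (auto simp: br_closed subspace_carrier)

lemma lie_algebra_subspace:
  assumes "subspace h" "h \<subseteq> g" "\<And>x y. x \<in> h \<Longrightarrow> y \<in> h \<Longrightarrow> br x y \<in> h"
  shows "lie_algebra scale h br"
proof
  show "subspace h" by (fact assms(1))
qed (use assms(2,3) in \<open>auto simp: subset_iff br_add_left br_add_right br_scale_left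
  br_scale_right br_alternating jacobi\<close>)

end

section \<open>Orthogonality and dimension bounds in a quadratic Lie algebra\<close>

context quadratic_lie_algebra
begin

lemma form_add_right: "\<lbrakk>x \<in> g; y \<in> g; z \<in> g\<rbrakk> \<Longrightarrow> B x (y + z) = B x y + B x z"
  using form_add_left[of y z x] form_sym[of x] subspace_add[OF subspace_carrier] by simp

lemma form_scale_right: "\<lbrakk>x \<in> g; y \<in> g\<rbrakk> \<Longrightarrow> B x (scale c y) = c * B x y"
  using form_scale_left[of y x c] form_sym[of x] subspace_scale[OF subspace_carrier] by simp

lemma form_zero_left: "x \<in> g \<Longrightarrow> B 0 x = 0"
  using form_add_left[of 0 0 x] subspace_0[OF subspace_carrier] by simp

lemma form_zero_right: "x \<in> g \<Longrightarrow> B x 0 = 0"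
  using form_add_right[of x 0 0] subspace_0[OF subspace_carrier] by simp

lemma subspace_orthogonal:
  assumes "subspace V" "V \<subseteq> g" "x \<in> g"
  shows "subspace {y \<in> V. B x y = 0}"
  unfolding subspace_def using assms
  by (auto simp: subset_iff form_zero_right form_add_right form_scale_right
      subspace_0 subspace_add subspace_scale)

lemma form_eq_0_on_span:
  assumes "x \<in> g" "D \<subseteq> g" "\<And>d. d \<in> D \<Longrightarrow> B x d = 0" "y \<in> span D"
  shows "B x y = 0"
proof -
  have "span D \<subseteq> {y \<in> g. B x y = 0}"
    using assms by (intro span_minimal subspace_orthogonal subspace_carrier) auto
  then show ?thesis using assms by blast
qed

text \<open>Closure under the bracket and nondegeneracy are the only axioms that do not restrict to
  a subspace automatically.\<close>

lemma quadratic_subspace: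
  assumes "subspace h" "h \<subseteq> g" "\<And>x y. x \<in> h \<Longrightarrow> y \<in> h \<Longrightarrow> br x y \<in> h"
    and "\<And>x. x \<in> h \<Longrightarrow> (\<And>y. y \<in> h \<Longrightarrow> B x y = 0) \<Longrightarrow> x = 0"
  shows "quadratic_lie_algebra scale h br B"
proof -
  interpret h: lie_algebra scale h br
    using assms(1-3) by (rule lie_algebra_subspace)
  show ?thesis
  proof
    show "x = 0" if "x \<in> h" "\<And>y. y \<in> h \<Longrightarrow> B x y = 0" for x
      using assms(4) that .
    show "B x y = B y x" if "x \<in> h" "y \<in> h" for x y
      using that assms(2) by (intro form_sym) auto
  qed (use assms(2) in \<open>auto simp: subset_iff form_add_left form_scale_left form_invariant\<close>)
qed

text \<open>Extend a basis \<open>A\<close> of \<open>U\<close> to a basis \<open>C\<close> of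
  \<open>g\<close>. An element of \<open>U\<close> is orthogonal to \<open>A\<close> by isotropy; if
  it is also orthogonal to \<open>C - A\<close>, nondegeneracy makes it 0. So dim g - dim U linear
  equations cut \<open>U\<close> down to 0.\<close>

lemma dim_isotropic_le:
  assumes fin: "finite S" "g \<subseteq> span S" and U: "subspace U" "U \<subseteq> g" "totally_isotropic B U"
  shows "2 * dim U \<le> dim g"
proof -
  obtain A where A: "A \<subseteq> U" "independent A" "U \<subseteq> span A" "card A = dim U"
    by (rule basis_exists)
  have "A \<subseteq> g" using A U by blast
  then obtain C where C: "A \<subseteq> C" "C \<subseteq> g" "independent C" "g \<subseteq> span C"
    using A maximal_independent_subset_extend by metis
  have finC: "finite C"
    using independent_span_bound[of S C] C fin by blast
  have cardC: "card C = dim g"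
    using C basis_card_eq_dim by blast
  have "{x \<in> U. \<forall>c\<in>C - A. B x c = 0} = {0}"
  proof
    show "{x \<in> U. \<forall>c\<in>C - A. B x c = 0} \<subseteq> {0}"
    proof
      fix x assume x: "x \<in> {x \<in> U. \<forall>c\<in>C - A. B x c = 0}"
      have "B x c = 0" if "c \<in> C" for c
        using x that A U unfolding totally_isotropic_def by blast
      then have "B x y = 0" if "y \<in> g" for y
        using form_eq_0_on_span[of x C y] x that C U by blast
      then show "x \<in> {0}" using form_nondegenerate[of x] x U by blast
    qed
    show "{0} \<subseteq> {x \<in> U. \<forall>c\<in>C - A. B x c = 0}"
      using U C by (auto simp: subspace_0 form_zero_left)
  qed
  moreover have "dim U \<le> dim {x \<in> U. \<forall>c\<in>C - A. B x c = 0} + card (C - A)"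
  proof (rule dim_le_dim_common_kernel[OF fin(1) _ U(1)])
    show "U \<subseteq> span S" using U fin by blast
    show "B (x + y) c = B x c + B y c" if "c \<in> C - A" "x \<in> U" "y \<in> U" for c x y
      using that U C by (intro form_add_left) auto
    show "B (scale k x) c = k * B x c" if "c \<in> C - A" "x \<in> U" for c k x
      using that U C by (intro form_scale_left) auto
  qed (use finC in simp)
  ultimately have "dim U \<le> card (C - A)" by (simp add: dim_zero_subspace)
  also have "\<dots> = dim g - dim U"
    using A C finC cardC by (metis card_Diff_subset finite_subset)
  finally have "dim U \<le> dim g - dim U" .
  \<comment> \<open>The subtraction of naturals truncates at 0, so this bound is required before
    rearranging.\<close>
  moreover have "dim U \<le> dim g"
    using A C finC cardC card_mono by metis
  ultimately show ?thesis by simp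
qed

text \<open>The orthogonal of [g,g] is cut out by dim [g,g] linear equations. It lies in the center:
  for such x, B([x,y],w) = B(x,[y,w]) = 0 for all w, hence [x,y] = 0.\<close>

lemma dim_le_dim_center_add_dim_derived:
  assumes fin: "finite S" "g \<subseteq> span S"
  shows "dim g \<le> dim (lie_center g br) + dim (derived_algebra scale g br)"
proof -
  have "derived_algebra scale g br \<subseteq> span S"
    using derived_algebra_subset fin by blast
  then obtain D where D: "finite D" "D \<subseteq> derived_algebra scale g br"
    "derived_algebra scale g br \<subseteq> span D" "card D = dim (derived_algebra scale g br)"
    using finite_basis_of_subset[OF fin(1)] by metis
  have Dg: "D \<subseteq> g" using D derived_algebra_subset by blast
  let ?P = "{x \<in> g. \<forall>d\<in>D. B x d = 0}"
  have "?P \<subseteq> lie_center g br"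
  proof
    fix x assume x: "x \<in> ?P"
    have "br x y = 0" if y: "y \<in> g" for y
    proof (rule form_nondegenerate)
      show "br x y \<in> g" using x y br_closed by blast
      fix w assume w: "w \<in> g"
      have "br y w \<in> span D" using br_in_derived_algebra[OF y w] D by blast
      then have "B x (br y w) = 0" using form_eq_0_on_span[of x D] x Dg by blast
      then show "B (br x y) w = 0" using form_invariant[of x y w] x y w by simp
    qed
    then show "x \<in> lie_center g br" using x by (simp add: lie_center_def)
  qed
  moreover have "lie_center g br \<subseteq> span S"
    using fin by (auto simp: lie_center_def)
  ultimately have "dim ?P \<le> dim (lie_center g br)"
    using dim_mono_finite fin by blast
  moreover have "dim g \<le> dim ?P + card D"
  proof (rule dim_le_dim_common_kernel[OF fin subspace_carrier D(1)])
    show "B (x + y) d = B x d + B y d" if "d \<in> D" "x \<in> g" "y \<in> g" for d x y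
      using that Dg by (intro form_add_left) auto
    show "B (scale k x) d = k * B x d" if "d \<in> D" "x \<in> g" for d k x
      using that Dg by (intro form_scale_left) auto
  qed
  ultimately show ?thesis using D by simp
qed

lemma totally_isotropicI:
  assumes "subspace U" "U \<subseteq> g" "\<And>x. x \<in> U \<Longrightarrow> B x x = 0"
  shows "totally_isotropic B U"
  unfolding totally_isotropic_def
proof (intro ballI)
  fix u v assume uv: "u \<in> U" "v \<in> U"
  then have g: "u \<in> g" "v \<in> g" using assms by auto
  have uvg: "u + v \<in> g" using g subspace_add[OF subspace_carrier] by blast
  have "0 = B (u + v) (u + v)" using assms uv by (simp add: subspace_add)
  also have "\<dots> = 2 * B u v"
    using assms(3) uv g uvg form_sym[OF g] by (simp add: form_add_left form_add_right)
  finally show "B u v = 0" by simp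
qed

end

section \<open>Orthogonal splittings of \<open>g\<close> with a central summand\<close>

locale central_splitting = quadratic_lie_algebra scale g br B
  for scale :: "complex \<Rightarrow> 'a::ab_group_add \<Rightarrow> 'a" and g br B +
  fixes z l :: "'a set"
  assumes subspace_z: "subspace z" and z_central: "z \<subseteq> lie_center g br"
    and subspace_l: "subspace l" and splits: "direct_sum_of g z l"
    and orthogonal: "orthogonal_wrt B l z"
begin

lemma z_subset: "z \<subseteq> g"
  using z_central by (auto simp: lie_center_def)

lemma l_subset: "l \<subseteq> g"
proof
  fix w assume "w \<in> l"
  then have "0 + w \<in> g"
    using splits subspace_0[OF subspace_z] unfolding direct_sum_of_def by blast
  then show "w \<in> g" by simp
qed

lemma z_Int_l: "z \<inter> l = {0}"
  using splits by (simp add: direct_sum_of_def)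

lemma form_l_z: "\<lbrakk>w \<in> l; u \<in> z\<rbrakk> \<Longrightarrow> B w u = 0"
  using orthogonal by (simp add: orthogonal_wrt_def)

lemma form_z_l: "\<lbrakk>w \<in> l; u \<in> z\<rbrakk> \<Longrightarrow> B u w = 0"
  using form_l_z form_sym z_subset l_subset by (metis subsetD)

lemma decompose:
  assumes "x \<in> g"
  obtains u w where "u \<in> z" "w \<in> l" "x = u + w"
  using assms splits unfolding direct_sum_of_def by blast

lemma br_z_left: "\<lbrakk>u \<in> z; x \<in> g\<rbrakk> \<Longrightarrow> br u x = 0"
  using z_central by (auto simp: lie_center_def)

lemma br_z_right: "\<lbrakk>u \<in> z; x \<in> g\<rbrakk> \<Longrightarrow> br x u = 0"
  using z_central lie_center_right by blast

lemma br_components: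
  assumes "u \<in> z" "w \<in> l" "u' \<in> z" "w' \<in> l"
  shows "br (u + w) (u' + w') = br w w'"
proof -
  have g: "u \<in> g" "w \<in> g" "u' \<in> g" "w' \<in> g"
    using assms z_subset l_subset by auto
  then have "u' + w' \<in> g" using subspace_add[OF subspace_carrier] by blast
  then show ?thesis
    using assms g by (simp add: br_add_left br_add_right br_z_left br_z_right)
qed

text \<open>By orthogonality the \<open>l\<close>-component of any vector pairs to 0 with
  \<open>u\<close>, so an element of the radical of B on \<open>z\<close> lies in the radical of B
  on \<open>g\<close>.\<close>

lemma nondegenerate_z:
  assumes "u \<in> z" "\<And>v. v \<in> z \<Longrightarrow> B u v = 0"
  shows "u = 0"
proof (rule form_nondegenerate)
  show u: "u \<in> g" using assms z_subset by blast
  fix x assume "x \<in> g"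
  then obtain v w where vw: "v \<in> z" "w \<in> l" "x = v + w" by (rule decompose)
  then have "B u x = B u v + B u w"
    using u z_subset l_subset by (auto intro: form_add_right)
  then show "B u x = 0" using assms vw form_z_l by simp
qed

lemma nondegenerate_l:
  assumes "x \<in> l" "\<And>y. y \<in> l \<Longrightarrow> B x y = 0"
  shows "x = 0"
proof (rule form_nondegenerate)
  show x: "x \<in> g" using assms l_subset by blast
  fix y assume "y \<in> g"
  then obtain v w where vw: "v \<in> z" "w \<in> l" "y = v + w" by (rule decompose)
  then have "B x y = B x v + B x w"
    using x z_subset l_subset by (auto intro: form_add_right)
  then show "B x y = 0" using assms vw form_l_z by simp
qed

text \<open>The \<open>z\<close>-component of \<open>x\<close> pairs with \<open>z\<close> exactly
  as \<open>x\<close> does, so it vanishes by nondegeneracy on \<open>z\<close>.\<close>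

lemma in_l_if_orthogonal_z:
  assumes "x \<in> g" "\<And>v. v \<in> z \<Longrightarrow> B x v = 0"
  shows "x \<in> l"
proof -
  obtain u w where uw: "u \<in> z" "w \<in> l" "x = u + w" using assms(1) by (rule decompose)
  have "u = 0"
  proof (rule nondegenerate_z[OF uw(1)])
    fix v assume v: "v \<in> z"
    have "B x v = B u v + B w v"
      using uw v z_subset l_subset by (auto intro: form_add_left)
    then show "B u v = 0" using assms(2) v form_l_z uw by simp
  qed
  then show ?thesis using uw by simp
qed

text \<open>Invariance gives B([x,y],v) = B(x,[y,v]) = 0 for central v. Hence \<open>l\<close>,
  assumed only to be a subspace, is an ideal.\<close>

lemma br_in_l:
  assumes "x \<in> g" "y \<in> g"
  shows "br x y \<in> l"
proof (rule in_l_if_orthogonal_z)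
  show "br x y \<in> g" using assms br_closed by blast
  fix v assume v: "v \<in> z"
  then show "B (br x y) v = 0"
    using form_invariant[of x y v] assms z_subset br_z_right form_zero_right by auto
qed

lemma lie_ideal_z: "lie_ideal scale g br z"
  unfolding lie_ideal_def using subspace_z z_subset br_z_right subspace_0 by auto

lemma lie_ideal_l: "lie_ideal scale g br l"
  unfolding lie_ideal_def using subspace_l l_subset br_in_l by auto

lemma quadratic_z: "quadratic_lie_algebra scale z br B"
proof (rule quadratic_subspace[OF subspace_z z_subset])
  show "br x y \<in> z" if "x \<in> z" "y \<in> z" for x y
    using that z_subset br_z_left subspace_0[OF subspace_z] by auto
qed (fact nondegenerate_z)

lemma quadratic_l: "quadratic_lie_algebra scale l br B"
proof (rule quadratic_subspace[OF subspace_l l_subset])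
  show "br x y \<in> l" if "x \<in> l" "y \<in> l" for x y
    using that l_subset by (auto intro: br_in_l)
qed (fact nondegenerate_l)

lemma abelian_if_abelian_l:
  assumes "abelian l br"
  shows "abelian g br"
  unfolding abelian_def
proof (intro ballI)
  fix x y assume "x \<in> g" "y \<in> g"
  then obtain u w u' w' where "u \<in> z" "w \<in> l" "x = u + w" "u' \<in> z" "w' \<in> l" "y = u' + w'"
    by (metis decompose)
  then show "br x y = 0" using br_components assms by (simp add: abelian_def)
qed

text \<open>This is the projection onto \<open>l\<close> along \<open>z\<close>, which serves to
  pull linear forms on \<open>l\<close> back to \<open>g\<close>. Its values are chosen pointwise;
  uniqueness of components then forces linearity.\<close>

lemma ex_projection:
  "\<exists>p. (\<forall>x\<in>g. \<forall>y\<in>g. p (x + y) = p x + p y) \<and> (\<forall>c. \<forall>x\<in>g. p (scale c x) = scale c (p x)) \<and>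
    (\<forall>x\<in>g. p x \<in> l \<and> x - p x \<in> z)"
proof -
  have "\<forall>x. \<exists>w. x \<in> g \<longrightarrow> w \<in> l \<and> x - w \<in> z"
  proof
    fix x
    have "\<exists>w. w \<in> l \<and> x - w \<in> z" if "x \<in> g"
    proof -
      obtain u w where "u \<in> z" "w \<in> l" "x = u + w" using \<open>x \<in> g\<close> by (rule decompose)
      then show ?thesis by (intro exI[of _ w]) simp
    qed
    then show "\<exists>w. x \<in> g \<longrightarrow> w \<in> l \<and> x - w \<in> z" by blast
  qed
  then obtain p where p: "\<And>x. x \<in> g \<Longrightarrow> p x \<in> l \<and> x - p x \<in> z"
    by metis
  have unique: "w = w'" if "w \<in> l" "x - w \<in> z" "w' \<in> l" "x - w' \<in> z" for x w w'
  proof -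
    have "w - w' \<in> l" using that subspace_l subspace_diff by blast
    moreover have "(x - w') - (x - w) \<in> z" using that subspace_z subspace_diff by blast
    ultimately have "w - w' \<in> z \<inter> l" by simp
    then have "w - w' \<in> {0}" by (simp only: z_Int_l)
    then show ?thesis by simp
  qed
  have "p (x + y) = p x + p y" if "x \<in> g" "y \<in> g" for x y
  proof (rule unique)
    have xy: "x + y \<in> g" using that subspace_add[OF subspace_carrier] by blast
    show "p (x + y) \<in> l" "x + y - p (x + y) \<in> z" using p[OF xy] by auto
    show "p x + p y \<in> l" using that p subspace_add[OF subspace_l] by blast
    have "(x - p x) + (y - p y) \<in> z" using that p subspace_add[OF subspace_z] by blast
    then show "x + y - (p x + p y) \<in> z" by (simp add: algebra_simps)
  qed
  moreover have "p (scale c x) = scale c (p x)" if "x \<in> g" for c x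
  proof (rule unique)
    have cx: "scale c x \<in> g" using that subspace_scale[OF subspace_carrier] by blast
    show "p (scale c x) \<in> l" "scale c x - p (scale c x) \<in> z" using p[OF cx] by auto
    show "scale c (p x) \<in> l" using that p subspace_scale[OF subspace_l] by blast
    have "scale c (x - p x) \<in> z" using that p subspace_scale[OF subspace_z] by blast
    then show "scale c x - scale c (p x) \<in> z" by (simp add: scale_right_diff_distrib)
  qed
  ultimately show ?thesis using p by blast
qed

text \<open>Linear forms restrict from \<open>g\<close> to \<open>l\<close>. Conversely they are
  composed with the projection \<open>p\<close>, because the trilinear form of \<open>g\<close> at
  (x,y,v) equals that of \<open>l\<close> at (p x, p y, p v).\<close>

lemma elementary_l_iff: "elementary scale l br B \<longleftrightarrow> elementary scale g br B"
proof
  have "linear_form_on scale l w" if "linear_form_on scale g w" for w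
    using that l_subset by (auto simp: linear_form_on_def subset_iff)
  moreover assume "elementary scale g br B"
  ultimately show "elementary scale l br B"
    unfolding elementary_def using l_subset by (meson subsetD)
next
  assume "elementary scale l br B"
  then obtain w1 w2 w3 where
    w: "linear_form_on scale l w1" "linear_form_on scale l w2" "linear_form_on scale l w3"
    and eq: "\<And>x y v. x \<in> l \<Longrightarrow> y \<in> l \<Longrightarrow> v \<in> l \<Longrightarrow> B (br x y) v = wedge3 w1 w2 w3 x y v"
    unfolding elementary_def by blast
  obtain p where p_add: "\<And>x y. x \<in> g \<Longrightarrow> y \<in> g \<Longrightarrow> p (x + y) = p x + p y"
    and p_scale: "\<And>c x. x \<in> g \<Longrightarrow> p (scale c x) = scale c (p x)"
    and p_l: "\<And>x. x \<in> g \<Longrightarrow> p x \<in> l" and p_z: "\<And>x. x \<in> g \<Longrightarrow> x - p x \<in> z"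
    using ex_projection by blast
  have lin: "linear_form_on scale g (\<lambda>x. v (p x))" if "linear_form_on scale l v" for v
    using that p_add p_scale p_l unfolding linear_form_on_def by simp
  have "B (br x y) v = wedge3 (\<lambda>x. w1 (p x)) (\<lambda>x. w2 (p x)) (\<lambda>x. w3 (p x)) x y v"
    if xyv: "x \<in> g" "y \<in> g" "v \<in> g" for x y v
  proof -
    have br: "br x y = br (p x) (p y)"
      using br_components[of "x - p x" "p x" "y - p y" "p y"] p_l p_z xyv by simp
    have brl: "br (p x) (p y) \<in> l" using br br_in_l xyv by metis
    have "B (br x y) v = B (br (p x) (p y)) ((v - p v) + p v)" using br by simp
    also have "\<dots> = B (br (p x) (p y)) (v - p v) + B (br (p x) (p y)) (p v)"
      \<comment> \<open>The bracket lies in \<open>l\<close>, so it is orthogonal to the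
        \<open>z\<close>-component v - p v, which drops out next.\<close>
      using brl p_l[OF xyv(3)] p_z[OF xyv(3)] l_subset z_subset by (intro form_add_right) auto
    also have "\<dots> = B (br (p x) (p y)) (p v)"
      using form_l_z[OF brl p_z[OF xyv(3)]] by simp
    also have "\<dots> = wedge3 w1 w2 w3 (p x) (p y) (p v)"
      using eq p_l xyv by simp
    finally show ?thesis by (simp add: wedge3_def)
  qed
  then show "elementary scale g br B"
    unfolding elementary_def using lin[OF w(1)] lin[OF w(2)] lin[OF w(3)] by blast
qed

text \<open>Since \<open>z\<close> is central, commuting with \<open>l\<close> already means
  commuting with \<open>g\<close>. This allows an element of the center of \<open>l\<close> to be
  moved into the central summand.\<close>

lemma lie_center_l_subset: "lie_center l br \<subseteq> lie_center g br"
proof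
  fix x assume x: "x \<in> lie_center l br"
  have "br x y = 0" if y: "y \<in> g" for y
  proof -
    obtain u w where uw: "u \<in> z" "w \<in> l" "y = u + w" using y by (rule decompose)
    then show ?thesis
      using br_components[of 0 x u w] x subspace_0[OF subspace_z] by (simp add: lie_center_def)
  qed
  then show "x \<in> lie_center g br" using x l_subset by (auto simp: lie_center_def)
qed

text \<open>The descent step: the line through \<open>x\<close> joins \<open>z\<close>, and
  \<open>l\<close> is replaced by its part orthogonal to \<open>x\<close>. The inclusion is strict
  because \<open>x\<close> itself leaves \<open>l\<close>.\<close>

lemma split_off_nonisotropic:
  assumes x: "x \<in> lie_center l br" and nz: "B x x \<noteq> 0"
  shows "\<exists>z' l'. central_splitting scale g br B z' l' \<and> l' \<subset> l"
proof -
  have xl: "x \<in> l" using x by (simp add: lie_center_def)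
  then have xg: "x \<in> g" using l_subset by blast
  define z' where "z' = {u + v | u v. u \<in> z \<and> v \<in> span {x}}"
  define l' where "l' = {y \<in> l. B x y = 0}"
  have z'E: "\<exists>u c. u \<in> z \<and> v = u + scale c x" if "v \<in> z'" for v
    using that unfolding z'_def span_singleton by blast
  have z'I: "u + scale c x \<in> z'" if "u \<in> z" for u c
    using that unfolding z'_def span_singleton by blast
  have "central_splitting scale g br B z' l'"
  proof (intro central_splitting.intro central_splitting_axioms.intro)
    show "quadratic_lie_algebra scale g br B" by unfold_locales
    show "subspace z'" unfolding z'_def by (rule subspace_sums[OF subspace_z subspace_span])
    show "subspace l'" unfolding l'_def by (rule subspace_orthogonal[OF subspace_l l_subset xg])
    show z'_central: "z' \<subseteq> lie_center g br"
    proof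
      fix v assume "v \<in> z'"
      then obtain u c where "u \<in> z" "v = u + scale c x" using z'E by blast
      then show "v \<in> lie_center g br"
        using z_central lie_center_l_subset x
        by (blast intro: subspace_add[OF subspace_lie_center] subspace_scale[OF subspace_lie_center])
    qed
    show "direct_sum_of g z' l'"
      unfolding direct_sum_of_def
    proof
      show "g = {u + w |u w. u \<in> z' \<and> w \<in> l'}"
      proof
        show "{u + w |u w. u \<in> z' \<and> w \<in> l'} \<subseteq> g"
          using z'_central l_subset subspace_add[OF subspace_carrier]
          by (auto simp: lie_center_def l'_def subset_iff)
        show "g \<subseteq> {u + w |u w. u \<in> z' \<and> w \<in> l'}"
        proof
          fix y assume "y \<in> g"
          then obtain u w where uw: "u \<in> z" "w \<in> l" "y = u + w" by (rule decompose)
          \<comment> \<open>The coefficient of the orthogonal projection of \<open>w\<close> onto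
            the line of \<open>x\<close>; subtracting it makes the remainder orthogonal to
            \<open>x\<close>.\<close>
          let ?c = "B x w / B x x"
          have m: "scale (- ?c) x \<in> l" using xl subspace_scale[OF subspace_l] by blast
          have wg: "w \<in> g" "scale (- ?c) x \<in> g" using uw m l_subset by auto
          have "B x (w + scale (- ?c) x) = B x w + - ?c * B x x"
            using wg xg by (simp only: form_add_right form_scale_right)
          moreover have "w + scale (- ?c) x \<in> l"
            using uw(2) m by (rule subspace_add[OF subspace_l])
          ultimately have "w + scale (- ?c) x \<in> l'"
            using nz by (simp add: l'_def)
          moreover have "y = (u + scale ?c x) + (w + scale (- ?c) x)"
            using uw by (simp add: algebra_simps)
          ultimately show "y \<in> {u + w |u w. u \<in> z' \<and> w \<in> l'}"
            using z'I[OF uw(1)] by blast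
        qed
      qed
      show "z' \<inter> l' = {0}"
      proof
        show "{0} \<subseteq> z' \<inter> l'"
          using \<open>subspace z'\<close> \<open>subspace l'\<close> subspace_0 by blast
        show "z' \<inter> l' \<subseteq> {0}"
        proof
          \<comment> \<open>Writing v = u + c x, membership in \<open>l\<close> kills u; then 0 =
            B(x,v) = c B(x,x) forces c = 0.\<close>
          fix v assume v: "v \<in> z' \<inter> l'"
          then obtain u c where uc: "u \<in> z" "v = u + scale c x" using z'E by blast
          have cx: "scale c x \<in> l" using xl subspace_scale[OF subspace_l] by blast
          have "v \<in> l" using v by (simp add: l'_def)
          then have "v - scale c x \<in> l" using cx subspace_diff[OF subspace_l] by blast
          then have "u \<in> z \<inter> l" using uc by simp
          then have "u \<in> {0}" by (simp only: z_Int_l)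
          then have "u = 0" by simp
          then have "v = scale c x" using uc by simp
          moreover have "B x v = 0" using v by (simp add: l'_def)
          ultimately show "v \<in> {0}" using nz form_scale_right[OF xg xg] by simp
        qed
      qed
    qed
    show "orthogonal_wrt B l' z'"
      unfolding orthogonal_wrt_def
    proof (intro ballI)
      fix w v assume w: "w \<in> l'" and "v \<in> z'"
      then obtain u c where uc: "u \<in> z" "v = u + scale c x" using z'E by blast
      have wl: "w \<in> l" "B x w = 0" using w by (auto simp: l'_def)
      have g: "w \<in> g" "u \<in> g" "scale c x \<in> g"
        using wl uc xg l_subset z_subset subspace_scale[OF subspace_carrier] by auto
      have "B w x = 0" using form_sym[OF g(1) xg] wl by simp
      then show "B w v = 0"
        using g xg uc form_l_z[OF wl(1) uc(1)] by (simp add: form_add_right form_scale_right)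
    qed
  qed
  moreover have "l' \<subset> l" using xl nz by (auto simp: l'_def)
  ultimately show ?thesis by blast
qed

end

section \<open>Choice of a splitting whose noncentral summand has minimal dimension\<close>

theorem proposition6p2p1:
  fixes scale :: "complex \<Rightarrow> 'a::ab_group_add \<Rightarrow> 'a"
    and g :: "'a set"
    and br :: "'a \<Rightarrow> 'a \<Rightarrow> 'a"
    and B :: "'a \<Rightarrow> 'a \<Rightarrow> complex"
  assumes "quadratic_lie_algebra scale g br B"
    and "finite_dim scale g"
    and "\<not> abelian g br"
  shows "\<exists>z l.
    lie_ideal scale g br z \<and> z \<subseteq> lie_center g br \<and>
    lie_ideal scale g br l \<and> l \<noteq> {0} \<and>
    direct_sum_of g z l \<and> orthogonal_wrt B l z \<and>
    quadratic_lie_algebra scale z br B \<and>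
    quadratic_lie_algebra scale l br B \<and>
    \<not> abelian l br \<and>
    (elementary scale l br B \<longleftrightarrow> elementary scale g br B) \<and>
    totally_isotropic B (lie_center l br) \<and>
    real (vector_space.dim scale (lie_center l br)) \<le> real (vector_space.dim scale l) / 2 \<and>
    real (vector_space.dim scale l) / 2 \<le> real (vector_space.dim scale (derived_algebra scale l br))"
proof -
  interpret quadratic_lie_algebra scale g br B by (fact assms(1))
  obtain S where "finite S" "span S = g" using assms(2) by (auto simp: finite_dim_def)
  then have fin: "finite S" "g \<subseteq> span S" by auto
  let ?P = "\<lambda>n. \<exists>z l. central_splitting scale g br B z l \<and> dim l = n"
  \<comment> \<open>The trivial splitting shows that some dimension is attained, so the
    \<open>LEAST\<close> below is attained too.\<close>
  have "central_splitting scale g br B {0} g"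
  proof
    show "subspace {0}" by simp
    show "{0} \<subseteq> lie_center g br" using subspace_0[OF subspace_lie_center] by simp
    show "subspace g" by (fact subspace_carrier)
    show "direct_sum_of g {0} g"
      using subspace_0[OF subspace_carrier] by (auto simp: direct_sum_of_def)
    show "orthogonal_wrt B g {0}" by (simp add: orthogonal_wrt_def form_zero_right)
  qed
  then have "?P (dim g)" by blast
  then have "?P (LEAST n. ?P n)" by (rule LeastI)
  then obtain z l where zl: "central_splitting scale g br B z l"
    and least: "dim l = (LEAST n. ?P n)" by blast
  interpret central_splitting scale g br B z l by (fact zl)
  interpret l: quadratic_lie_algebra scale l br B by (rule quadratic_l)
  have finl: "l \<subseteq> span S" using l_subset fin by blast
  have sub: "lie_center l br \<subseteq> l" by (auto simp: lie_center_def)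
  have isotropic: "totally_isotropic B (lie_center l br)"
  proof (rule l.totally_isotropicI[OF l.subspace_lie_center sub])
    fix x assume x: "x \<in> lie_center l br"
    show "B x x = 0"
    proof (rule ccontr)
      assume "B x x \<noteq> 0"
      then obtain z' l' where l': "central_splitting scale g br B z' l'" "l' \<subset> l"
        using split_off_nonisotropic x by blast
      have "subspace l'" by (rule central_splitting.subspace_l[OF l'(1)])
      then have "dim l' < dim l" using dim_less_of_psubset[OF fin(1) finl] l'(2) by blast
      moreover have "dim l \<le> dim l'" unfolding least by (rule Least_le) (use l' in blast)
      ultimately show False by simp
    qed
  qed
  have "2 * dim (lie_center l br) \<le> dim l"
    by (rule l.dim_isotropic_le[OF fin(1) finl l.subspace_lie_center sub isotropic])
  \<comment> \<open>With 2 dim Z(l) \<le> dim l, this leaves at least half of dim l for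
    [l,l].\<close>
  moreover have "dim l \<le> dim (lie_center l br) + dim (derived_algebra scale l br)"
    by (rule l.dim_le_dim_center_add_dim_derived[OF fin(1) finl])
  ultimately have dims: "real (dim (lie_center l br)) \<le> real (dim l) / 2"
    "real (dim l) / 2 \<le> real (dim (derived_algebra scale l br))"
    by linarith+
  have nonabelian: "\<not> abelian l br" using abelian_if_abelian_l assms(3) by blast
  then have "l \<noteq> {0}"
    by (auto simp: abelian_def l.br_zero_left)
  then show ?thesis
    by (intro exI[of _ z] exI[of _ l] conjI lie_ideal_z z_central lie_ideal_l splits orthogonal
        quadratic_z quadratic_l nonabelian elementary_l_iff isotropic dims)
qed

end
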